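(* Let $n\ge 3$. The assignment on generators $$\phi(a'_{ijk}) = a_{ij,ik}\,a_{kj,ki}\qquad (i,j,k\in\{1,\dots,n\}\text{ pairwise distinct})$$ gives a well-defined map (group homomorphism) $\phi\colon {}'G_n^3\to G_{n(n-1)}^2$.
   Context: Definition of ${}'G_n^3$ ($n\ge 3$): the group with generators $a'_{ijk}$, where $i,j,k\in\{1,\dots,n\}$ are pairwise distinct and ordered triples are taken up to order reversal only, i.e. $a'_{ijk}=a'_{kji}$ (so there are $3\binom{n}{3}$ generators; e.g. $a'_{123}=a'_{321}\ne a'_{132}$), and relations: (1) $(a'_{ijk})^2=1$ for all pairwise distinct $i,j,k$; (2) $a'_{ijk}a'_{pqr}=a'_{pqr}a'_{ijk}$ whenever $|\{i,j,k\}|=|\{p,q,r\}|=3$ and $|\{i,j,k\}\cap\{p,q,r\}|\le 1$; (3) $a'_{ijk}a'_{ijl}a'_{ikl}a'_{jkl}=a'_{jkl}a'_{ikl}a'_{ijl}a'_{ijk}$ for all pairwise distinct $i,j,k,l$. Definition of $G_{n(n-1)}^2$: let $P$ be the set of the $n(n-1)$ ordered pairs $ij$ of distinct elements $i\neq j$ of $\{1,\dots,n\}$ (so $ij\ne ji$ as elements of $P$). $G_{n(n-1)}^2$ is the group with generators $a_{p,q}$ for distinct $p,q\in P$, with $a_{p,q}=a_{q,p}$ (generators are indexed by two-element subsets of $P$), and relations: $a_{p,q}^2=1$; $a_{p,q}a_{r,s}=a_{r,s}a_{p,q}$ for pairwise distinct $p,q,r,s\in P$; $(a_{p,q}a_{p,r}a_{q,r})^2=1$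 for pairwise distinct $p,q,r\in P$. For instance, $a_{12,23}$ is the generator indexed by the two ordered pairs $(1,2)$ and $(2,3)$. *)

theory Defs
  imports "HOL-Algebra.Group" "HOL-Library.FuncSet"
begin

section \<open>Groups given by generators and relations\<close>

text \<open>A letter \<open>(x, True)\<close> stands for the generator \<open>x\<close>, and \<open>(x, False)\<close> for its
  formal inverse.\<close>

type_synonym 'g gword = "('g \<times> bool) list"

definition gwords :: "'g set \<Rightarrow> 'g gword set" where
  "gwords X = lists (X \<times> UNIV)"

definition pos_word :: "'g list \<Rightarrow> 'g gword" where
  "pos_word xs = map (\<lambda>x. (x, True)) xs"

text \<open>A pair \<open>(u, v)\<close> of words in \<open>R\<close> is the relation \<open>u = v\<close>. The quotient of the monoid of words
  by the least congruence containing \<open>R\<close> and the cancellation of adjacent mutually inverse letters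
  is the group \<open>\<langle>X | R\<rangle>\<close>.\<close>

inductive_set pres_eq :: "'g set \<Rightarrow> ('g gword \<times> 'g gword) set \<Rightarrow> ('g gword \<times> 'g gword) set"
  for X :: "'g set" and R :: "('g gword \<times> 'g gword) set" where
  refl: "u \<in> gwords X \<Longrightarrow> (u, u) \<in> pres_eq X R"
| sym: "(u, v) \<in> pres_eq X R \<Longrightarrow> (v, u) \<in> pres_eq X R"
| trans: "(u, v) \<in> pres_eq X R \<Longrightarrow> (v, w) \<in> pres_eq X R \<Longrightarrow> (u, w) \<in> pres_eq X R"
| append: "(u, u') \<in> pres_eq X R \<Longrightarrow> (v, v') \<in> pres_eq X R \<Longrightarrow> (u @ v, u' @ v') \<in> pres_eq X R"
| cancel: "x \<in> X \<Longrightarrow> ([(x, b), (x, \<not> b)], []) \<in> pres_eq X R"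
| relation: "(u, v) \<in> R \<Longrightarrow> u \<in> gwords X \<Longrightarrow> v \<in> gwords X \<Longrightarrow> (u, v) \<in> pres_eq X R"

definition pres_group :: "'g set \<Rightarrow> ('g gword \<times> 'g gword) set \<Rightarrow> 'g gword set monoid" where
  "pres_group X R =
    \<lparr>carrier = gwords X // pres_eq X R,
     mult = (\<lambda>A B. \<Union>u\<in>A. \<Union>v\<in>B. pres_eq X R `` {u @ v}),
     one = pres_eq X R `` {[]}\<rparr>"

definition pres_gen :: "'g set \<Rightarrow> ('g gword \<times> 'g gword) set \<Rightarrow> 'g \<Rightarrow> 'g gword set" where
  "pres_gen X R x = pres_eq X R `` {pos_word [x]}"

lemma gwords_simps [simp]:
  "[] \<in> gwords X"
  "(x, b) # w \<in> gwords X \<longleftrightarrow> x \<in> X \<and> w \<in> gwords X"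
  "u @ v \<in> gwords X \<longleftrightarrow> u \<in> gwords X \<and> v \<in> gwords X"
  by (auto simp: gwords_def)

lemma pres_eq_gwords: "(u, v) \<in> pres_eq X R \<Longrightarrow> u \<in> gwords X \<and> v \<in> gwords X"
  by (induction rule: pres_eq.induct) auto

lemma equiv_pres_eq: "equiv (gwords X) (pres_eq X R)"
proof (rule equivI)
  show "pres_eq X R \<subseteq> gwords X \<times> gwords X"
    using pres_eq_gwords by fastforce
  show "refl_on (gwords X) (pres_eq X R)"
    by (simp add: refl_on_def pres_eq.refl)
  show "Relation.sym (pres_eq X R)"
    by (rule symI) (rule pres_eq.sym)
  show "Relation.trans (pres_eq X R)"
    by (rule transI) (rule pres_eq.trans)
qed

lemma UN2_constant:
  assumes "a \<in> A" "b \<in> B" "\<And>x y. x \<in> A \<Longrightarrow> y \<in> B \<Longrightarrow> f x y = C"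
  shows "(\<Union>x\<in>A. \<Union>y\<in>B. f x y) = C"
  using assms by fast

lemma pres_mult_class:
  assumes "u \<in> gwords X" "v \<in> gwords X"
  shows "pres_eq X R `` {u} \<otimes>\<^bsub>pres_group X R\<^esub> pres_eq X R `` {v} = pres_eq X R `` {u @ v}"
proof -
  have *: "pres_eq X R `` {u' @ v'} = pres_eq X R `` {u @ v}"
    if "(u, u') \<in> pres_eq X R" "(v, v') \<in> pres_eq X R" for u' v'
    using equiv_class_eq[OF equiv_pres_eq pres_eq.append[OF that]] by simp
  have "u \<in> pres_eq X R `` {u}" "v \<in> pres_eq X R `` {v}"
    using assms by (simp_all add: pres_eq.refl)
  moreover have "pres_eq X R `` {u' @ v'} = pres_eq X R `` {u @ v}"
    if "u' \<in> pres_eq X R `` {u}" "v' \<in> pres_eq X R `` {v}" for u' v'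
    by (rule *) (use that in simp_all)
  ultimately have "(\<Union>u'\<in>pres_eq X R `` {u}. \<Union>v'\<in>pres_eq X R `` {v}. pres_eq X R `` {u' @ v'}) =
      pres_eq X R `` {u @ v}"
    by (rule UN2_constant)
  then show ?thesis
    by (simp only: pres_group_def monoid.simps)
qed

lemma pres_inverse_word:
  assumes "w \<in> gwords X"
  shows "\<exists>w'\<in>gwords X. (w' @ w, []) \<in> pres_eq X R"
  using assms
proof (induction w)
  case Nil
  then show ?case by (auto intro!: bexI[of _ "[]"] pres_eq.refl)
next
  case (Cons a w)
  obtain x b where a: "a = (x, b)" by (cases a)
  with Cons.prems have x: "x \<in> X" and w: "w \<in> gwords X" by simp_all
  from Cons.IH[OF w] obtain w' where w': "w' \<in> gwords X" "(w' @ w, []) \<in> pres_eq X R" by blast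
  have "([(x, \<not> b), (x, b)], []) \<in> pres_eq X R"
    using pres_eq.cancel[OF x, of "\<not> b" R] by simp
  from pres_eq.append[OF pres_eq.refl[OF w'(1)] pres_eq.append[OF this pres_eq.refl[OF w]]]
  have "((w' @ [(x, \<not> b)]) @ a # w, w' @ w) \<in> pres_eq X R" by (simp add: a)
  from pres_eq.trans[OF this w'(2)] show ?case
    using w'(1) x by (intro bexI[of _ "w' @ [(x, \<not> b)]"]) auto
qed

lemma group_pres_group: "group (pres_group X R)"
proof -
  let ?c = "\<lambda>u. pres_eq X R `` {u}"
  have car: "carrier (pres_group X R) = ?c ` gwords X"
    by (auto simp: pres_group_def quotient_def)
  have one: "\<one>\<^bsub>pres_group X R\<^esub> = ?c []"
    by (simp add: pres_group_def)
  show ?thesis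
  proof (rule groupI)
    fix A assume "A \<in> carrier (pres_group X R)"
    then obtain w where w: "w \<in> gwords X" "A = ?c w" by (auto simp: car)
    from pres_inverse_word[OF w(1)] obtain w'
      where w': "w' \<in> gwords X" "(w' @ w, []) \<in> pres_eq X R" by blast
    then show "\<exists>B\<in>carrier (pres_group X R). B \<otimes>\<^bsub>pres_group X R\<^esub> A = \<one>\<^bsub>pres_group X R\<^esub>"
      using equiv_class_eq[OF equiv_pres_eq w'(2)] w
      by (intro bexI[of _ "?c w'"]) (simp_all add: car one pres_mult_class)
  qed (auto simp: car one pres_mult_class simp del: Image_singleton_iff)
qed


section \<open>The group \<open>'G\<^sub>n\<^sup>3\<close>\<close>

text \<open>An ordered triple up to reversal is represented by its class \<open>{(i, j, k), (k, j, i)}\<close>.\<close>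

definition triple :: "nat \<Rightarrow> nat \<Rightarrow> nat \<Rightarrow> (nat \<times> nat \<times> nat) set" where
  "triple i j k = {(i, j, k), (k, j, i)}"

definition G3_gens :: "nat \<Rightarrow> (nat \<times> nat \<times> nat) set set" where
  "G3_gens n = {triple i j k | i j k. {i, j, k} \<subseteq> {1..n} \<and> distinct [i, j, k]}"

definition G3_rels ::
  "nat \<Rightarrow> ((nat \<times> nat \<times> nat) set gword \<times> (nat \<times> nat \<times> nat) set gword) set" where
  "G3_rels n =
    {(pos_word [triple i j k, triple i j k], []) | i j k.
      {i, j, k} \<subseteq> {1..n} \<and> distinct [i, j, k]} \<union>
    {(pos_word [triple i j k, triple p q r], pos_word [triple p q r, triple i j k]) | i j k p q r.
      {i, j, k} \<subseteq> {1..n} \<and> {p, q, r} \<subseteq> {1..n} \<and>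
      card {i, j, k} = 3 \<and> card {p, q, r} = 3 \<and> card ({i, j, k} \<inter> {p, q, r}) \<le> 1} \<union>
    {(pos_word [triple i j k, triple i j l, triple i k l, triple j k l],
      pos_word [triple j k l, triple i k l, triple i j l, triple i j k]) | i j k l.
      {i, j, k, l} \<subseteq> {1..n} \<and> distinct [i, j, k, l]}"

definition G3 :: "nat \<Rightarrow> (nat \<times> nat \<times> nat) set gword set monoid" where
  "G3 n = pres_group (G3_gens n) (G3_rels n)"

definition a3 :: "nat \<Rightarrow> nat \<Rightarrow> nat \<Rightarrow> nat \<Rightarrow> (nat \<times> nat \<times> nat) set gword set" where
  "a3 n i j k = pres_gen (G3_gens n) (G3_rels n) (triple i j k)"


section \<open>The group \<open>G\<^sup>2\<close> on an index set \<open>P\<close>\<close>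

definition G2_gens :: "'p set \<Rightarrow> 'p set set" where
  "G2_gens P = {{p, q} | p q. {p, q} \<subseteq> P \<and> p \<noteq> q}"

definition G2_rels :: "'p set \<Rightarrow> ('p set gword \<times> 'p set gword) set" where
  "G2_rels P =
    {(pos_word [{p, q}, {p, q}], []) | p q. {p, q} \<subseteq> P \<and> p \<noteq> q} \<union>
    {(pos_word [{p, q}, {r, s}], pos_word [{r, s}, {p, q}]) | p q r s.
      {p, q, r, s} \<subseteq> P \<and> distinct [p, q, r, s]} \<union>
    {(pos_word [{p, q}, {p, r}, {q, r}, {p, q}, {p, r}, {q, r}], []) | p q r.
      {p, q, r} \<subseteq> P \<and> distinct [p, q, r]}"

definition G2 :: "'p set \<Rightarrow> 'p set gword set monoid" where
  "G2 P = pres_group (G2_gens P) (G2_rels P)"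

definition a2 :: "'p set \<Rightarrow> 'p \<Rightarrow> 'p \<Rightarrow> 'p set gword set" where
  "a2 P p q = pres_gen (G2_gens P) (G2_rels P) {p, q}"

definition ordered_pairs :: "nat \<Rightarrow> (nat \<times> nat) set" where
  "ordered_pairs n = {(i, j). i \<in> {1..n} \<and> j \<in> {1..n} \<and> i \<noteq> j}"

end

theory Submission
  imports Defs
begin

text \<open>By the universal property of a presentation only the relations of \<open>'G\<^sub>n\<^sup>3\<close> have to be checked on
  the images. Generators \<open>a\<^bsub>p,q\<^esub>\<close> and \<open>a\<^bsub>r,s\<^esub>\<close> whose pairs have different first entries commute, so
  the image of a product splits according to the first entries. In relation (3) the factors with
  first entry \<open>k\<close> and \<open>j\<close> are single generators, while those with first entry \<open>i\<close> and \<open>l\<close> form words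
  \<open>a\<^bsub>p,q\<^esub> a\<^bsub>p,r\<^esub> a\<^bsub>q,r\<^esub>\<close>, which equal their reversals because they and their letters are
  involutions.\<close>

section \<open>The universal property of a presentation\<close>

definition word_eval :: "('a, 'b) monoid_scheme \<Rightarrow> ('g \<Rightarrow> 'a) \<Rightarrow> 'g gword \<Rightarrow> 'a" where
  "word_eval G f w =
    foldr (\<lambda>(x, b) y. (if b then f x else inv\<^bsub>G\<^esub> f x) \<otimes>\<^bsub>G\<^esub> y) w \<one>\<^bsub>G\<^esub>"

lemma word_eval_simps [simp]:
  "word_eval G f [] = \<one>\<^bsub>G\<^esub>"
  "word_eval G f ((x, b) # w) = (if b then f x else inv\<^bsub>G\<^esub> f x) \<otimes>\<^bsub>G\<^esub> word_eval G f w"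
  by (simp_all add: word_eval_def)

lemma pos_word_simps [simp]:
  "pos_word [] = []"
  "pos_word (x # xs) = (x, True) # pos_word xs"
  by (simp_all add: pos_word_def)

context group
begin

lemma word_eval_closed [simp]:
  assumes "f \<in> X \<rightarrow> carrier G" "w \<in> gwords X"
  shows "word_eval G f w \<in> carrier G"
  using assms(2)
proof (induction w)
  case (Cons a w)
  then show ?case using assms(1) by (cases a) auto
qed simp

lemma word_eval_append:
  assumes "f \<in> X \<rightarrow> carrier G" "u \<in> gwords X" "v \<in> gwords X"
  shows "word_eval G f (u @ v) = word_eval G f u \<otimes> word_eval G f v"
  using assms(2)
proof (induction u)
  case Nil
  then show ?case using assms by simp
next
  case (Cons a u)
  obtain x b where a: "a = (x, b)" by (cases a)
  with Cons.prems assms(1) have "f x \<in> carrier G" "u \<in> gwords X" by auto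
  with Cons.IH assms show ?case by (simp add: a m_assoc)
qed

text \<open>Having the same value under \<open>word_eval\<close> is a congruence on words over
  \<open>X\<close> that contains the cancellations and, by assumption, the relations;
  \<open>pres_eq\<close> is the least such congruence.\<close>

lemma word_eval_pres_eq:
  assumes f: "f \<in> X \<rightarrow> carrier G"
    and R: "\<And>u v. (u, v) \<in> R \<Longrightarrow> u \<in> gwords X \<Longrightarrow> v \<in> gwords X \<Longrightarrow> word_eval G f u = word_eval G f v"
    and "(u, v) \<in> pres_eq X R"
  shows "word_eval G f u = word_eval G f v"
  using assms(3)
proof (induction rule: pres_eq.induct)
  case (append u u' v v')
  then show ?case
    using pres_eq_gwords[of u u'] pres_eq_gwords[of v v'] f by (simp add: word_eval_append)
next
  case (cancel x b)
  then have "f x \<in> carrier G" using f by auto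
  then show ?case by simp
qed (use R in auto)

text \<open>Serves uniqueness: on the value of a word, a homomorphism is determined by the images of
  the letters.\<close>

lemma hom_word_eval:
  assumes "group_hom G H h" "f \<in> X \<rightarrow> carrier G" "w \<in> gwords X"
  shows "h (word_eval G f w) = word_eval H (h \<circ> f) w"
proof -
  interpret group_hom G H h by fact
  show ?thesis
    using assms(3)
  proof (induction w)
    case (Cons a w)
    obtain x b where a: "a = (x, b)" by (cases a)
    with Cons.prems assms(2) have "f x \<in> carrier G" "w \<in> gwords X" by auto
    with Cons.IH assms show ?case by (simp add: a)
  qed simp
qed

end

lemma word_eval_cong:
  assumes "\<And>x. x \<in> X \<Longrightarrow> f x = g x" "w \<in> gwords X"
  shows "word_eval G f w = word_eval G g w"
  using assms(2)
proof (induction w)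
  case (Cons a w)
  then show ?case using assms(1) by (cases a) auto
qed simp

section \<open>Classes of words in a presented group\<close>

lemma pres_class_closed: "w \<in> gwords X \<Longrightarrow> pres_eq X R `` {w} \<in> carrier (pres_group X R)"
  by (simp add: pres_group_def quotientI)

lemma pres_carrierE:
  assumes "A \<in> carrier (pres_group X R)"
  obtains w where "w \<in> gwords X" "A = pres_eq X R `` {w}"
  using assms by (auto simp: pres_group_def quotient_def)

lemma pres_gen_closed: "pres_gen X R \<in> X \<rightarrow> carrier (pres_group X R)"
  by (auto simp: pres_gen_def simp del: Image_singleton_iff intro!: pres_class_closed)

text \<open>Shows that the generators generate the presented group, and lets equalities of classes
  be read as equations between products of generators.\<close>

lemma word_eval_pres_gen:
  assumes "w \<in> gwords X"
  shows "word_eval (pres_group X R) (pres_gen X R) w = pres_eq X R `` {w}"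
  using assms
proof (induction w)
  case Nil
  then show ?case by (simp add: pres_group_def)
next
  case (Cons a w)
  interpret group "pres_group X R" by (rule group_pres_group)
  obtain x b where a: "a = (x, b)" by (cases a)
  with Cons.prems have x: "x \<in> X" and w: "w \<in> gwords X" by simp_all
  \<comment> \<open>The cancellation that starts with the inverse letter gives a left inverse of the
    generator, as \<open>inv_equality\<close> requires.\<close>
  have "pres_eq X R `` {[(x, False)]} \<otimes>\<^bsub>pres_group X R\<^esub> pres_eq X R `` {[(x, True)]} =
      \<one>\<^bsub>pres_group X R\<^esub>"
    using equiv_class_eq[OF equiv_pres_eq pres_eq.cancel[OF x, of False R]] x
    by (simp add: pres_mult_class) (simp add: pres_group_def)
  then have "inv\<^bsub>pres_group X R\<^esub> (pres_gen X R x) = pres_eq X R `` {[(x, False)]}"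
    unfolding pres_gen_def pos_word_simps using x by (intro inv_equality pres_class_closed) simp_all
  then have "(if b then pres_gen X R x else inv\<^bsub>pres_group X R\<^esub> pres_gen X R x) =
      pres_eq X R `` {[(x, b)]}"
    by (cases b) (simp_all add: pres_gen_def)
  with Cons.IH[OF w] show ?case
    using x w by (simp add: a pres_mult_class del: Image_singleton_iff)
qed

lemma pres_gen_relation:
  assumes "(u, v) \<in> R" "u \<in> gwords X" "v \<in> gwords X"
  shows "word_eval (pres_group X R) (pres_gen X R) u = word_eval (pres_group X R) (pres_gen X R) v"
  using assms equiv_class_eq[OF equiv_pres_eq pres_eq.relation[OF assms]]
  by (simp add: word_eval_pres_gen)

text \<open>Functions in HOL are total, so uniqueness can hold only once the values off the carrier
  are fixed; \<open>extensional\<close> does this.\<close>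

theorem pres_group_universal:
  assumes "group H"
    and f: "f \<in> X \<rightarrow> carrier H"
    and R: "\<And>u v. (u, v) \<in> R \<Longrightarrow> u \<in> gwords X \<Longrightarrow> v \<in> gwords X \<Longrightarrow> word_eval H f u = word_eval H f v"
  shows "\<exists>!\<phi>. \<phi> \<in> extensional (carrier (pres_group X R)) \<and> group_hom (pres_group X R) H \<phi> \<and>
    (\<forall>x\<in>X. \<phi> (pres_gen X R x) = f x)"
proof -
  interpret H: group H by fact
  let ?G = "pres_group X R"
  let ?c = "\<lambda>w. pres_eq X R `` {w}"
  \<comment> \<open>Each class is evaluated at an arbitrary representative; by
    \<open>word_eval_pres_eq\<close> the choice does not affect the value.\<close>
  define \<phi> where "\<phi> = restrict (\<lambda>A. word_eval H f (SOME w. w \<in> A)) (carrier ?G)"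
  have \<phi>: "\<phi> (?c w) = word_eval H f w" if w: "w \<in> gwords X" for w
  proof -
    have "w \<in> ?c w" using w by (simp add: pres_eq.refl)
    then have "(SOME w'. w' \<in> ?c w) \<in> ?c w" by (rule someI)
    then have "(w, SOME w'. w' \<in> ?c w) \<in> pres_eq X R" by simp
    from H.word_eval_pres_eq[OF f R this] show ?thesis
      using pres_class_closed[OF w, of R] by (simp add: \<phi>_def)
  qed
  show ?thesis
  proof (rule ex1I)
    have "\<phi> \<in> hom ?G H"
    proof (rule homI)
      fix A assume "A \<in> carrier ?G"
      then show "\<phi> A \<in> carrier H"
        by (elim pres_carrierE) (simp add: \<phi> H.word_eval_closed[OF f] del: Image_singleton_iff)
    next
      fix A B assume "A \<in> carrier ?G" "B \<in> carrier ?G"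
      then show "\<phi> (A \<otimes>\<^bsub>?G\<^esub> B) = \<phi> A \<otimes>\<^bsub>H\<^esub> \<phi> B"
        by (elim pres_carrierE)
          (simp add: pres_mult_class \<phi> H.word_eval_append[OF f] del: Image_singleton_iff)
    qed
    then have "group_hom ?G H \<phi>"
      by (simp add: group_hom_def group_hom_axioms_def group_pres_group H.is_group)
    moreover have "\<phi> (pres_gen X R x) = f x" if x: "x \<in> X" for x
    proof -
      have "f x \<in> carrier H" using f x by auto
      with x show ?thesis by (simp add: pres_gen_def \<phi> del: Image_singleton_iff)
    qed
    ultimately show "\<phi> \<in> extensional (carrier ?G) \<and> group_hom ?G H \<phi> \<and>
        (\<forall>x\<in>X. \<phi> (pres_gen X R x) = f x)"
      by (simp add: \<phi>_def)
  next
    fix \<psi> assume \<psi>: "\<psi> \<in> extensional (carrier ?G) \<and> group_hom ?G H \<psi> \<and>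
        (\<forall>x\<in>X. \<psi> (pres_gen X R x) = f x)"
    show "\<psi> = \<phi>"
    proof (rule extensionalityI)
      fix A assume "A \<in> carrier ?G"
      then obtain w where w: "w \<in> gwords X" "A = ?c w" by (rule pres_carrierE)
      \<comment> \<open>\<open>A\<close> is a product of generators and their inverses, where the
        value of \<open>\<psi>\<close> is forced by \<open>f\<close>.\<close>
      have "\<psi> A = \<psi> (word_eval ?G (pres_gen X R) w)"
        by (simp add: w word_eval_pres_gen)
      also have "\<dots> = word_eval H (\<psi> \<circ> pres_gen X R) w"
        using \<psi> w by (intro group.hom_word_eval[OF group_pres_group _ pres_gen_closed]) simp_all
      also have "\<dots> = word_eval H f w"
        using \<psi> w by (intro word_eval_cong[where X = X]) simp_all
      finally show "\<psi> A = \<phi> A" using \<phi> w by simp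
    qed (use \<psi> in \<open>auto simp: \<phi>_def\<close>)
  qed
qed


section \<open>The generators of \<open>G\<^sup>2\<close>\<close>

lemma group_G2: "group (G2 P)"
  unfolding G2_def by (rule group_pres_group)

lemma a2_sym: "a2 P p q = a2 P q p"
  by (simp add: a2_def insert_commute)

lemma G2_gensI: "p \<in> P \<Longrightarrow> q \<in> P \<Longrightarrow> p \<noteq> q \<Longrightarrow> {p, q} \<in> G2_gens P"
  by (auto simp: G2_gens_def)

lemma a2_closed: "p \<in> P \<Longrightarrow> q \<in> P \<Longrightarrow> p \<noteq> q \<Longrightarrow> a2 P p q \<in> carrier (G2 P)"
  unfolding a2_def G2_def by (rule funcset_mem[OF pres_gen_closed G2_gensI])

lemma a2_square:
  assumes "p \<in> P" "q \<in> P" "p \<noteq> q"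
  shows "a2 P p q \<otimes>\<^bsub>G2 P\<^esub> a2 P p q = \<one>\<^bsub>G2 P\<^esub>"
proof -
  interpret group "G2 P" by (rule group_G2)
  have "(pos_word [{p, q}, {p, q}], []) \<in> G2_rels P"
    using assms unfolding G2_rels_def by blast
  from pres_gen_relation[OF this, of "G2_gens P"] show ?thesis
    using assms a2_closed[OF assms]
    by (simp add: G2_gensI flip: a2_def G2_def)
qed

lemma a2_commute:
  assumes "{p, q, r, s} \<subseteq> P" "distinct [p, q, r, s]"
  shows "a2 P p q \<otimes>\<^bsub>G2 P\<^esub> a2 P r s = a2 P r s \<otimes>\<^bsub>G2 P\<^esub> a2 P p q"
proof -
  interpret group "G2 P" by (rule group_G2)
  have "(pos_word [{p, q}, {r, s}], pos_word [{r, s}, {p, q}]) \<in> G2_rels P"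
    using assms unfolding G2_rels_def by blast
  from pres_gen_relation[OF this, of "G2_gens P"] show ?thesis
    using assms by (simp add: G2_gensI a2_closed flip: a2_def G2_def)
qed

text \<open>The last assumption makes the product its own inverse; the inverse is the reversed
  product of the inverses, and each factor is its own inverse.\<close>

lemma (in group) involutive_product_rev:
  assumes [simp]: "x \<in> carrier G" "y \<in> carrier G" "z \<in> carrier G"
    and "x \<otimes> x = \<one>" "y \<otimes> y = \<one>" "z \<otimes> z = \<one>"
    and "x \<otimes> (y \<otimes> (z \<otimes> (x \<otimes> (y \<otimes> z)))) = \<one>"
  shows "x \<otimes> (y \<otimes> z) = z \<otimes> (y \<otimes> x)"
proof -
  have "x \<otimes> (y \<otimes> z) = inv (x \<otimes> (y \<otimes> z))"
    by (rule inv_equality[symmetric]) (simp_all add: m_assoc assms(7))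
  also have "\<dots> = inv z \<otimes> (inv y \<otimes> inv x)"
    by (simp add: inv_mult_group m_assoc)
  also have "\<dots> = z \<otimes> (y \<otimes> x)"
    by (simp only: inv_equality[OF assms(4)] inv_equality[OF assms(5)] inv_equality[OF assms(6)]
        assms(1-3))
  finally show ?thesis .
qed

text \<open>The form of the relation on three indices that suits the four-index relation of
  \<open>G3\<close>, whose two sides are reversals of each other.\<close>

lemma a2_triangle:
  assumes "{p, q, r} \<subseteq> P" "distinct [p, q, r]"
  shows "a2 P p q \<otimes>\<^bsub>G2 P\<^esub> (a2 P p r \<otimes>\<^bsub>G2 P\<^esub> a2 P q r) =
    a2 P q r \<otimes>\<^bsub>G2 P\<^esub> (a2 P p r \<otimes>\<^bsub>G2 P\<^esub> a2 P p q)"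
proof -
  interpret group "G2 P" by (rule group_G2)
  have "(pos_word [{p, q}, {p, r}, {q, r}, {p, q}, {p, r}, {q, r}], []) \<in> G2_rels P"
    using assms unfolding G2_rels_def by blast
  from pres_gen_relation[OF this, of "G2_gens P"]
  have "a2 P p q \<otimes>\<^bsub>G2 P\<^esub> (a2 P p r \<otimes>\<^bsub>G2 P\<^esub> (a2 P q r \<otimes>\<^bsub>G2 P\<^esub>
      (a2 P p q \<otimes>\<^bsub>G2 P\<^esub> (a2 P p r \<otimes>\<^bsub>G2 P\<^esub> a2 P q r)))) = \<one>\<^bsub>G2 P\<^esub>"
    using assms by (simp add: G2_gensI a2_closed flip: a2_def G2_def)
  then show ?thesis
    using assms by (intro involutive_product_rev) (simp_all add: a2_closed a2_square)
qed


section \<open>The images of the generators of \<open>'G\<^sub>n\<^sup>3\<close>\<close>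

definition triple_image :: "nat \<Rightarrow> nat \<Rightarrow> nat \<Rightarrow> nat \<Rightarrow> (nat \<times> nat) set gword set" where
  "triple_image n i j k = a2 (ordered_pairs n) (i, j) (i, k) \<otimes>\<^bsub>G2 (ordered_pairs n)\<^esub>
    a2 (ordered_pairs n) (k, j) (k, i)"

lemma triple_image_closed:
  assumes "{i, j, k} \<subseteq> {1..n}" "distinct [i, j, k]"
  shows "triple_image n i j k \<in> carrier (G2 (ordered_pairs n))"
proof -
  interpret group "G2 (ordered_pairs n)" by (rule group_G2)
  show ?thesis
    using assms unfolding triple_image_def
    by (intro m_closed a2_closed) (auto simp: ordered_pairs_def)
qed

text \<open>Reversal swaps the two factors, which commute because their first entries
  \<open>i\<close> and \<open>k\<close> differ. This is what makes the image depend only on the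
  triple up to reversal.\<close>

lemma triple_image_rev:
  assumes "{i, j, k} \<subseteq> {1..n}" "distinct [i, j, k]"
  shows "triple_image n k j i = triple_image n i j k"
  using assms unfolding triple_image_def
  by (intro a2_commute) (auto simp: ordered_pairs_def)

section \<open>Products of commuting elements\<close>

lemma (in group) left_commute:
  assumes "y \<otimes> x = x \<otimes> y" "x \<in> carrier G" "y \<in> carrier G" "z \<in> carrier G"
  shows "y \<otimes> (x \<otimes> z) = x \<otimes> (y \<otimes> z)"
  using assms by (simp flip: m_assoc)

lemma (in group) commuting_involutions_square:
  assumes "x \<in> carrier G" "y \<in> carrier G" "x \<otimes> x = \<one>" "y \<otimes> y = \<one>" "y \<otimes> x = x \<otimes> y"
  shows "(x \<otimes> y) \<otimes> (x \<otimes> y) = \<one>"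
proof -
  have "(x \<otimes> y) \<otimes> (x \<otimes> y) = (x \<otimes> x) \<otimes> (y \<otimes> y)"
    using assms(1,2) by (simp add: m_assoc left_commute[OF assms(5)])
  then show ?thesis using assms by simp
qed

lemma (in group) commuting_products:
  assumes "x \<in> carrier G" "y \<in> carrier G" "z \<in> carrier G" "w \<in> carrier G"
    and "z \<otimes> x = x \<otimes> z" "w \<otimes> x = x \<otimes> w" "z \<otimes> y = y \<otimes> z" "w \<otimes> y = y \<otimes> w"
  shows "(x \<otimes> y) \<otimes> (z \<otimes> w) = (z \<otimes> w) \<otimes> (x \<otimes> y)"
  using assms(1-4) by (simp add: m_assoc assms(5-8) left_commute[OF assms(5)]
      left_commute[OF assms(6)] left_commute[OF assms(7)] left_commute[OF assms(8)])

section \<open>The relations of \<open>G3\<close> on the images\<close>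

lemma triple_image_square:
  assumes "{i, j, k} \<subseteq> {1..n}" "distinct [i, j, k]"
  shows "triple_image n i j k \<otimes>\<^bsub>G2 (ordered_pairs n)\<^esub> triple_image n i j k =
    \<one>\<^bsub>G2 (ordered_pairs n)\<^esub>"
proof -
  interpret group "G2 (ordered_pairs n)" by (rule group_G2)
  show ?thesis
    unfolding triple_image_def
    by (rule commuting_involutions_square; (rule a2_closed a2_square a2_commute)?)
      (use assms in \<open>simp_all add: ordered_pairs_def\<close>)
qed

text \<open>Every factor of one image commutes with every factor of the other. First entries may
  coincide here, so the argument is instead that a common ordered pair would need two common
  indices.\<close>

lemma triple_image_commute:
  assumes "{i, j, k} \<subseteq> {1..n}" "distinct [i, j, k]" "{p, q, r} \<subseteq> {1..n}" "distinct [p, q, r]"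
    and "card ({i, j, k} \<inter> {p, q, r}) \<le> 1"
  shows "triple_image n i j k \<otimes>\<^bsub>G2 (ordered_pairs n)\<^esub> triple_image n p q r =
    triple_image n p q r \<otimes>\<^bsub>G2 (ordered_pairs n)\<^esub> triple_image n i j k"
proof -
  interpret group "G2 (ordered_pairs n)" by (rule group_G2)
  define A B where "A = {i, j, k}" and "B = {p, q, r}"
  have "finite (A \<inter> B)" by (simp add: A_def)
  moreover have "card (A \<inter> B) \<le> Suc 0" using assms(5) by (simp only: A_def B_def One_nat_def)
  ultimately have *: "\<forall>x\<in>A \<inter> B. \<forall>y\<in>A \<inter> B. x = y" by (simp only: card_le_Suc0_iff_eq)
  have disj: "(x, y) \<noteq> (z, w)" if "x \<in> A" "y \<in> A" "z \<in> B" "w \<in> B" "x \<noteq> y" for x y z w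
    using that * by blast
  \<comment> \<open>The set equations allow any ordering of each triple, so this one fact covers all
    four pairs of factors.\<close>
  have comm: "a2 (ordered_pairs n) (x, y) (x, y') \<otimes>\<^bsub>G2 (ordered_pairs n)\<^esub>
        a2 (ordered_pairs n) (z, w) (z, w') =
      a2 (ordered_pairs n) (z, w) (z, w') \<otimes>\<^bsub>G2 (ordered_pairs n)\<^esub>
        a2 (ordered_pairs n) (x, y) (x, y')"
    if "{x, y, y'} = {i, j, k}" "distinct [x, y, y']"
      "{z, w, w'} = {p, q, r}" "distinct [z, w, w']" for x y y' z w w'
  proof (rule a2_commute)
    have "{x, y, y'} \<subseteq> {1..n}" "{z, w, w'} \<subseteq> {1..n}"
      using that assms by simp_all
    with that(2,4) show "{(x, y), (x, y'), (z, w), (z, w')} \<subseteq> ordered_pairs n"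
      by (auto simp: ordered_pairs_def)
    have mem: "x \<in> A" "y \<in> A" "y' \<in> A" "z \<in> B" "w \<in> B" "w' \<in> B"
      unfolding A_def B_def that(1,3)[symmetric] by simp_all
    show "distinct [(x, y), (x, y'), (z, w), (z, w')]"
      using that(2,4) disj[OF mem(1,2,4,5)] disj[OF mem(1,2,4,6)] disj[OF mem(1,3,4,5)]
        disj[OF mem(1,3,4,6)]
      by simp
  qed
  show ?thesis
    unfolding triple_image_def
    by (rule commuting_products; rule comm[symmetric] a2_closed)
      (use assms(1-4) in \<open>simp_all add: ordered_pairs_def insert_commute\<close>)
qed

text \<open>The shape of relation (3) after applying the map: the letters \<open>x\<close> have first entry \<open>i\<close>, the
  letters \<open>y\<close> first entry \<open>l\<close>, and \<open>b\<close>, \<open>d\<close> have first entries \<open>k\<close>, \<open>j\<close>.\<close>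

lemma (in group) interleaved_products_rev:
  assumes carr: "{x1, x2, x3, y1, y2, y3, b, d} \<subseteq> carrier G"
    and xy: "\<forall>x\<in>{x1, x2, x3}. \<forall>y\<in>{y1, y2, y3, b, d}. y \<otimes> x = x \<otimes> y"
    and yb: "\<forall>y\<in>{y1, y2, y3}. \<forall>c\<in>{b, d}. c \<otimes> y = y \<otimes> c"
    and bd: "d \<otimes> b = b \<otimes> d"
    and x: "x1 \<otimes> (x2 \<otimes> x3) = x3 \<otimes> (x2 \<otimes> x1)"
    and y: "y1 \<otimes> (y2 \<otimes> y3) = y3 \<otimes> (y2 \<otimes> y1)"
  shows "(x1 \<otimes> b) \<otimes> ((x2 \<otimes> y1) \<otimes> ((x3 \<otimes> y2) \<otimes> (d \<otimes> y3))) =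
    (d \<otimes> y3) \<otimes> ((x3 \<otimes> y2) \<otimes> ((x2 \<otimes> y1) \<otimes> (x1 \<otimes> b)))"
proof -
  have [simp]: "x1 \<in> carrier G" "x2 \<in> carrier G" "x3 \<in> carrier G" "y1 \<in> carrier G"
    "y2 \<in> carrier G" "y3 \<in> carrier G" "b \<in> carrier G" "d \<in> carrier G"
    using carr by simp_all
  \<comment> \<open>Each commutation is also recorded in front of a further factor. As rewrite rules
    on right-nested products these sort the letters: first \<open>x\<close>, then \<open>y\<close>,
    then \<open>b\<close> and \<open>d\<close>, with the order inside the first two groups
    kept.\<close>
  have "\<forall>x\<in>{x1, x2, x3}. \<forall>y\<in>{y1, y2, y3, b, d}. y \<otimes> x = x \<otimes> y \<and>
      (\<forall>w\<in>carrier G. y \<otimes> (x \<otimes> w) = x \<otimes> (y \<otimes> w))"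
    using carr by (blast intro: xy[rule_format] left_commute)
  note xy' = this[unfolded ball_simps]
  have "\<forall>y\<in>{y1, y2, y3}. \<forall>c\<in>{b, d}. c \<otimes> y = y \<otimes> c \<and>
      (\<forall>w\<in>carrier G. c \<otimes> (y \<otimes> w) = y \<otimes> (c \<otimes> w))"
    using carr by (blast intro: yb[rule_format] left_commute)
  note yb' = this[unfolded ball_simps]
  have "(x1 \<otimes> b) \<otimes> ((x2 \<otimes> y1) \<otimes> ((x3 \<otimes> y2) \<otimes> (d \<otimes> y3))) =
      (x1 \<otimes> (x2 \<otimes> x3)) \<otimes> ((y1 \<otimes> (y2 \<otimes> y3)) \<otimes> (b \<otimes> d))"
    by (simp add: m_assoc xy' yb')
  also have "\<dots> = (x3 \<otimes> (x2 \<otimes> x1)) \<otimes> ((y3 \<otimes> (y2 \<otimes> y1)) \<otimes> (b \<otimes> d))"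
    by (simp only: x y)
  also have "\<dots> = (d \<otimes> y3) \<otimes> ((x3 \<otimes> y2) \<otimes> ((x2 \<otimes> y1) \<otimes> (x1 \<otimes> b)))"
    \<comment> \<open>On this side \<open>d\<close> comes before \<open>b\<close>, so sorting also
      has to swap these two.\<close>
    by (simp add: m_assoc xy' yb' bd left_commute[OF bd])
  finally show ?thesis .
qed

text \<open>The letters of an image start with the two end indices of its triple. Among the four
  triples, \<open>i\<close> and \<open>l\<close> are ends three times each, while \<open>k\<close>
  is an end only in \<open>i j k\<close> and \<open>j\<close> only in \<open>j k l\<close>; this is
  the pattern of \<open>interleaved_products_rev\<close>.\<close>

lemma triple_image_tetrahedron:
  fixes n
  defines "H \<equiv> G2 (ordered_pairs n)"
  assumes "{i, j, k, l} \<subseteq> {1..n}" "distinct [i, j, k, l]"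
  shows "triple_image n i j k \<otimes>\<^bsub>H\<^esub> (triple_image n i j l \<otimes>\<^bsub>H\<^esub>
      (triple_image n i k l \<otimes>\<^bsub>H\<^esub> triple_image n j k l)) =
    triple_image n j k l \<otimes>\<^bsub>H\<^esub> (triple_image n i k l \<otimes>\<^bsub>H\<^esub>
      (triple_image n i j l \<otimes>\<^bsub>H\<^esub> triple_image n i j k))"
proof -
  interpret group H unfolding H_def by (rule group_G2)
  let ?P = "ordered_pairs n"
  let ?a = "a2 ?P"
  have P: "(x, y) \<in> ?P" if "x \<in> {i, j, k, l}" "y \<in> {i, j, k, l}" "x \<noteq> y" for x y
    using that assms(2) by (auto simp: ordered_pairs_def)
  have comm: "?a (x, y) (x, y') \<otimes>\<^bsub>H\<^esub> ?a (z, w) (z, w') =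
      ?a (z, w) (z, w') \<otimes>\<^bsub>H\<^esub> ?a (x, y) (x, y')"
    if "(x, y) \<in> ?P" "(x, y') \<in> ?P" "(z, w) \<in> ?P" "(z, w') \<in> ?P" "x \<noteq> z" "y \<noteq> y'" "w \<noteq> w'"
    for x y y' z w w'
    unfolding H_def using that by (intro a2_commute) auto
  have l: "?a (l, j) (l, i) \<otimes>\<^bsub>H\<^esub> (?a (l, k) (l, i) \<otimes>\<^bsub>H\<^esub> ?a (l, k) (l, j)) =
      ?a (l, k) (l, j) \<otimes>\<^bsub>H\<^esub> (?a (l, k) (l, i) \<otimes>\<^bsub>H\<^esub> ?a (l, j) (l, i))"
    using a2_triangle[of "(l, i)" "(l, j)" "(l, k)" ?P] assms(3) P
    \<comment> \<open>The images list the pairs starting with \<open>l\<close> in the opposite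
      order, so each letter is first brought to the orientation of
      \<open>a2_triangle\<close>.\<close>
    by (simp add: H_def a2_sym[of _ "(l, j)" "(l, i)"] a2_sym[of _ "(l, k)"])
  have i: "?a (i, j) (i, k) \<otimes>\<^bsub>H\<^esub> (?a (i, j) (i, l) \<otimes>\<^bsub>H\<^esub> ?a (i, k) (i, l)) =
      ?a (i, k) (i, l) \<otimes>\<^bsub>H\<^esub> (?a (i, j) (i, l) \<otimes>\<^bsub>H\<^esub> ?a (i, j) (i, k))"
    unfolding H_def using assms(3) P by (intro a2_triangle) auto
  have carr: "{?a (i, j) (i, k), ?a (i, j) (i, l), ?a (i, k) (i, l), ?a (l, j) (l, i),
      ?a (l, k) (l, i), ?a (l, k) (l, j), ?a (k, j) (k, i), ?a (j, k) (j, l)} \<subseteq> carrier H"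
    unfolding H_def insert_subset
    by (intro conjI a2_closed P) (use assms(3) in auto)
  have xy: "\<forall>x\<in>{?a (i, j) (i, k), ?a (i, j) (i, l), ?a (i, k) (i, l)}. \<forall>y\<in>{?a (l, j) (l, i),
      ?a (l, k) (l, i), ?a (l, k) (l, j), ?a (k, j) (k, i), ?a (j, k) (j, l)}.
      y \<otimes>\<^bsub>H\<^esub> x = x \<otimes>\<^bsub>H\<^esub> y"
    and yb: "\<forall>y\<in>{?a (l, j) (l, i), ?a (l, k) (l, i), ?a (l, k) (l, j)}.
      \<forall>c\<in>{?a (k, j) (k, i), ?a (j, k) (j, l)}. c \<otimes>\<^bsub>H\<^esub> y = y \<otimes>\<^bsub>H\<^esub> c"
    and bd: "?a (j, k) (j, l) \<otimes>\<^bsub>H\<^esub> ?a (k, j) (k, i) = ?a (k, j) (k, i) \<otimes>\<^bsub>H\<^esub> ?a (j, k) (j, l)"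
    unfolding ball_simps simp_thms by (intro conjI comm P; use assms(3) in simp)+
  show ?thesis
    unfolding triple_image_def H_def[symmetric]
    by (rule interleaved_products_rev[OF carr xy yb bd i l])
qed

section \<open>The map on generators\<close>

text \<open>A generator is a class of two triples, so an image has to be chosen among those of its
  orderings; \<open>triple_image_rev\<close> makes them agree.\<close>

definition gen_image :: "nat \<Rightarrow> (nat \<times> nat \<times> nat) set \<Rightarrow> (nat \<times> nat) set gword set" where
  "gen_image n T = (SOME g. \<exists>i j k. {i, j, k} \<subseteq> {1..n} \<and> distinct [i, j, k] \<and>
    T = triple i j k \<and> g = triple_image n i j k)"

lemma gen_image_triple:
  assumes "{i, j, k} \<subseteq> {1..n}" "distinct [i, j, k]"
  shows "gen_image n (triple i j k) = triple_image n i j k"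
  unfolding gen_image_def
proof (rule some_equality)
  fix g
  assume "\<exists>i' j' k'. {i', j', k'} \<subseteq> {1..n} \<and> distinct [i', j', k'] \<and>
    triple i j k = triple i' j' k' \<and> g = triple_image n i' j' k'"
  then show "g = triple_image n i j k"
    using triple_image_rev[OF assms] by (auto simp: triple_def doubleton_eq_iff)
qed (use assms in blast)

lemma gen_image_closed: "gen_image n \<in> G3_gens n \<rightarrow> carrier (G2 (ordered_pairs n))"
  unfolding G3_gens_def by (auto simp: gen_image_triple triple_image_closed)

lemma gen_image_relation:
  assumes "(u, v) \<in> G3_rels n"
  shows "word_eval (G2 (ordered_pairs n)) (gen_image n) u =
    word_eval (G2 (ordered_pairs n)) (gen_image n) v"
proof -
  interpret group "G2 (ordered_pairs n)" by (rule group_G2)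
  \<comment> \<open>The commutation relations express distinctness by cardinality.\<close>
  have card3: "distinct [i, j, k]" if "card {i, j, k} = 3" for i j k :: nat
    using that card_distinct[of "[i, j, k]"] by simp
  from assms show ?thesis
    unfolding G3_rels_def
  proof (elim UnE CollectE exE conjE)
    fix i j k
    assume "(u, v) = (pos_word [triple i j k, triple i j k], [])"
      and "{i, j, k} \<subseteq> {1..n}" "distinct [i, j, k]"
    then show ?thesis
      using triple_image_square[of i j k n] triple_image_closed[of i j k n]
      by (simp add: gen_image_triple)
  next
    fix i j k p q r
    assume "(u, v) = (pos_word [triple i j k, triple p q r], pos_word [triple p q r, triple i j k])"
      and range: "{i, j, k} \<subseteq> {1..n}" "{p, q, r} \<subseteq> {1..n}"
      and "card {i, j, k} = 3" "card {p, q, r} = 3"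
      and card: "card ({i, j, k} \<inter> {p, q, r}) \<le> 1"
    moreover from this have "distinct [i, j, k]" "distinct [p, q, r]"
      by (simp_all only: card3)
    ultimately show ?thesis
      using triple_image_commute[OF range(1) _ range(2) _ card]
      by (simp add: gen_image_triple triple_image_closed del: One_nat_def)
  next
    fix i j k l
    assume "(u, v) = (pos_word [triple i j k, triple i j l, triple i k l, triple j k l],
        pos_word [triple j k l, triple i k l, triple i j l, triple i j k])"
      and "{i, j, k, l} \<subseteq> {1..n}" "distinct [i, j, k, l]"
    then show ?thesis
      using triple_image_tetrahedron[of i j k l n]
      by (simp add: gen_image_triple triple_image_closed)
  qed
qed

text \<open>Well-definedness is rendered as unique existence of a homomorphism with the prescribed
  values on the generators.\<close>

theorem lemma1:
  fixes n :: nat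
  assumes "n \<ge> 3"
  shows "\<exists>!\<phi>. \<phi> \<in> extensional (carrier (G3 n)) \<and>
    group_hom (G3 n) (G2 (ordered_pairs n)) \<phi> \<and>
    (\<forall>i\<in>{1..n}. \<forall>j\<in>{1..n}. \<forall>k\<in>{1..n}. distinct [i, j, k] \<longrightarrow>
      \<phi> (a3 n i j k) =
        a2 (ordered_pairs n) (i, j) (i, k) \<otimes>\<^bsub>G2 (ordered_pairs n)\<^esub>
        a2 (ordered_pairs n) (k, j) (k, i))"
proof -
  \<comment> \<open>Stated as an equivalence for every \<open>\<phi>\<close>, so that it can rewrite
    the condition under the unique existence quantifier.\<close>
  have gens: "(\<forall>T\<in>G3_gens n. \<phi> (pres_gen (G3_gens n) (G3_rels n) T) = gen_image n T) \<longleftrightarrow>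
      (\<forall>i\<in>{1..n}. \<forall>j\<in>{1..n}. \<forall>k\<in>{1..n}. distinct [i, j, k] \<longrightarrow>
        \<phi> (a3 n i j k) = triple_image n i j k)" (is "?L \<longleftrightarrow> ?R") for \<phi>
  proof
    assume L: ?L
    show ?R
    proof (intro ballI impI)
      fix i j k assume ijk: "i \<in> {1..n}" "j \<in> {1..n}" "k \<in> {1..n}" "distinct [i, j, k]"
      then have "triple i j k \<in> G3_gens n" unfolding G3_gens_def by blast
      with L ijk show "\<phi> (a3 n i j k) = triple_image n i j k"
        by (simp add: a3_def gen_image_triple)
    qed
  next
    assume R: ?R
    show ?L
    proof
      fix T assume "T \<in> G3_gens n"
      then obtain i j k where "{i, j, k} \<subseteq> {1..n}" "distinct [i, j, k]" "T = triple i j k"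
        unfolding G3_gens_def by blast
      with R show "\<phi> (pres_gen (G3_gens n) (G3_rels n) T) = gen_image n T"
        by (simp add: gen_image_triple flip: a3_def)
    qed
  qed
  have "\<exists>!\<phi>. \<phi> \<in> extensional (carrier (pres_group (G3_gens n) (G3_rels n))) \<and>
      group_hom (pres_group (G3_gens n) (G3_rels n)) (G2 (ordered_pairs n)) \<phi> \<and>
      (\<forall>T\<in>G3_gens n. \<phi> (pres_gen (G3_gens n) (G3_rels n) T) = gen_image n T)"
    by (rule pres_group_universal[OF group_G2 gen_image_closed gen_image_relation])
  then show ?thesis
    unfolding gens triple_image_def G3_def[symmetric] .
qed

end
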